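(* Let $f$ and $g$ be two (formal) power series in the same indeterminate $x$ with coefficients in a commutative ring $R$. Then $$f\ast g=\big(\,\overline{f^*}\odot g^*\big)'+\overline{f^*}\,\diamond_{1}\,g^*,$$ where $f\ast g$ is the convolution (ordinary Cauchy product) of $f$ and $g$, and, for $n$ a power of $2$, the operator $\diamond_n$ on pairs of power series is defined recursively by $$u\diamond_n v=(1+x^n)\Big(\big(x^nu_{\mathrm{low}}^{(n)}-u_{\mathrm{high}}^{(n)}\big)\odot\big(x^nv_{\mathrm{low}}^{(n)}+v_{\mathrm{high}}^{(n)}\big)\Big)'+u\diamond_{2n}v+(1+x^n)\Big(\big(x^nu_{\mathrm{low}}^{(n)}-u_{\mathrm{high}}^{(n)}\big)\diamond_{2n}\big(x^nv_{\mathrm{low}}^{(n)}+v_{\mathrm{high}}^{(n)}\big)\Big).$$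
   Context: Notation. For power series $u=\sum_j u_jx^j$ and $v=\sum_j v_jx^j$, the termwise product is $u\odot v=\sum_j u_jv_jx^j$; juxtaposition is the ordinary product. Sierpiński triangle: $T_{n,k}\in\{0,1\}$ is the residue of $\binom{n}{k}$ modulo $2$ (read as an integer). Sierpiński's polynomials: $S_m=\sum_{j=0}^m T_{m,j}x^j$. The power series $\delta_k$ is the expansion of $(1-x)^{-1}S_k^{-1}$, i.e. $\delta_k=\dfrac{1}{(1-x)S_k}\in\mathbb Z[[x]]$. For $n$ a power of $2$ and a power series $u$, $u_{\mathrm{low}}^{(n)}=u\odot\delta_n$ and $u_{\mathrm{high}}^{(n)}=u\odot(x^n\delta_n)$. Signed Thue–Morse sequence: $\sigma_j=(-1)^{h(j)}$, where $h(j)$ is the number of digits $1$ in the binary expansion of $j\ge 0$. For a power series $u=\sum_j u_jx^j$, $\overline{u}=\sum_j\sigma_ju_jx^j$. For a power series $u=\sum_n u_nx^n$, its binomial modulo 2 transform is $u'=\sum_{n\ge0}\Big(\sum_{k=0}^nT_{n,k}u_k\Big)x^n$ and its binomial modulo 2 inverse transform is $u^*=\sum_{n\ge0}\Big(\sum_{k=0}^n\sigma_{n-k}T_{n,k}u_k\Big)x^n$ (the prime does not denote a derivative). Meaning of the non-terminating recursion: for a power of two $N$, let $\diamond_n^{[N]}$ be given by $u\diamond_n^{[N]}v=0$ for $n\ge N$ and by the displayed recursion (with $\diamond_n,\diamond_{2n}$ replaced by $\diamond_n^{[N]},\diamond_{2n}^{[N]}$) for $n<N$; then $u\diamond_nv$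 is the coefficientwise limit of $u\diamond_n^{[N]}v$ as $N\to\infty$ through powers of $2$ (each coefficient is eventually constant in $N$). Integer-coefficient series are regarded as having coefficients in $R$ via the canonical map $\mathbb Z\to R$. *)

theory Defs
  imports "HOL-Computational_Algebra.Polynomial_FPS"
begin

unbundle fps_syntax

section \<open>Sierpinski triangle, Sierpinski polynomials, Thue--Morse signs\<close>

definition sierp :: "nat \<Rightarrow> nat \<Rightarrow> nat" where
  "sierp n k = (n choose k) mod 2"

definition sierp_poly :: "nat \<Rightarrow> int poly" where
  "sierp_poly m = (\<Sum>j=0..m. monom (int (sierp m j)) j)"

text \<open>
  \<open>int\<close> is not an instance of class \<open>inverse\<close>, so \<open>1 / ((1 - x) S\<^sub>k)\<close> in the ring of integer
  power series is the right inverse of a series with constant coefficient 1; see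
  \<open>sierp_delta_inverse\<close> below.
\<close>
definition sierp_delta :: "nat \<Rightarrow> int fps" where
  "sierp_delta k = fps_right_inverse ((1 - fps_X) * fps_of_poly (sierp_poly k)) 1"

definition thue_morse :: "nat \<Rightarrow> int" where
  "thue_morse j = (-1) ^ card {i. bit j i}"

lemma sierp_delta_inverse:
  "((1 - fps_X) * fps_of_poly (sierp_poly k)) * sierp_delta k = 1"
proof -
  have "coeff (sierp_poly k) 0 = 1"
    by (simp add: sierp_poly_def coeff_sum sierp_def)
  then have "((1 - fps_X) * fps_of_poly (sierp_poly k)) $ 0 * 1 = 1"
    by simp
  then show ?thesis
    unfolding sierp_delta_def by (rule fps_right_inverse)
qed

section \<open>Operations on power series\<close>

definition fps_of_int_fps :: "int fps \<Rightarrow> 'a::comm_ring_1 fps" where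
  "fps_of_int_fps u = Abs_fps (\<lambda>j. of_int (u $ j))"

definition termwise :: "'a::comm_ring_1 fps \<Rightarrow> 'a fps \<Rightarrow> 'a fps" (infixl "\<odot>" 70) where
  "u \<odot> v = Abs_fps (\<lambda>j. u $ j * v $ j)"

definition fps_low :: "nat \<Rightarrow> 'a::comm_ring_1 fps \<Rightarrow> 'a fps" where
  "fps_low n u = u \<odot> fps_of_int_fps (sierp_delta n)"

definition fps_high :: "nat \<Rightarrow> 'a::comm_ring_1 fps \<Rightarrow> 'a fps" where
  "fps_high n u = u \<odot> fps_of_int_fps (fps_X ^ n * sierp_delta n)"

definition fps_signed :: "'a::comm_ring_1 fps \<Rightarrow> 'a fps" where
  "fps_signed u = Abs_fps (\<lambda>j. of_int (thue_morse j) * u $ j)"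

definition bin2_transform :: "'a::comm_ring_1 fps \<Rightarrow> 'a fps" where
  "bin2_transform u = Abs_fps (\<lambda>n. \<Sum>k=0..n. of_nat (sierp n k) * u $ k)"

definition bin2_inverse_transform :: "'a::comm_ring_1 fps \<Rightarrow> 'a fps" where
  "bin2_inverse_transform u =
     Abs_fps (\<lambda>n. \<Sum>k=0..n. of_int (thue_morse (n - k)) * of_nat (sierp n k) * u $ k)"

section \<open>The operators \<open>\<diamondop>\<close>\<close>

text \<open>
  The truncated recursion. Only powers of two matter for \<open>n\<close> and \<open>N\<close>; the guard \<open>n = 0\<close> is there
  for termination.
\<close>
function diamond_trunc :: "nat \<Rightarrow> nat \<Rightarrow> 'a::comm_ring_1 fps \<Rightarrow> 'a fps \<Rightarrow> 'a fps" where
  "diamond_trunc N n u v =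
     (if n = 0 \<or> n \<ge> N then 0
      else (1 + fps_X ^ n) *
             bin2_transform ((fps_X ^ n * fps_low n u - fps_high n u) \<odot>
                             (fps_X ^ n * fps_low n v + fps_high n v))
         + diamond_trunc N (2 * n) u v
         + (1 + fps_X ^ n) *
             diamond_trunc N (2 * n) (fps_X ^ n * fps_low n u - fps_high n u)
                                     (fps_X ^ n * fps_low n v + fps_high n v))"
  by pat_completeness auto
termination
  by (relation "measure (\<lambda>(N, n, u, v). N - n)") auto

declare diamond_trunc.simps [simp del]

text \<open>
  The topology of \<open>'a fps\<close> is that of eventual constancy of each coefficient, see
  \<open>tendsto_fps_iff\<close>. Convergence is \<open>diamond_trunc_tendsto\<close> below, and \<open>diamond_rec\<close> shows that
  the limit satisfies the untruncated recursion.
\<close>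
definition diamond :: "'a::comm_ring_1 fps \<Rightarrow> nat \<Rightarrow> 'a fps \<Rightarrow> 'a fps"
    ("(_ \<diamondop>\<^bsub>_\<^esub> _)" [71, 0, 71] 70) where
  "u \<diamondop>\<^bsub>n\<^esub> v = lim (\<lambda>M. diamond_trunc (2 ^ M) n u v)"

lemma fps_mult_nth_cong:
  fixes f g h :: "'a::comm_ring_1 fps"
  assumes "\<And>i. i \<le> j \<Longrightarrow> g $ i = h $ i"
  shows "(f * g) $ j = (f * h) $ j"
  unfolding fps_mult_nth by (intro sum.cong) (auto simp: assms)

lemma diamond_head_nth:
  fixes u v :: "'a::comm_ring_1 fps"
  assumes "j < n"
  shows "((1 + fps_X ^ n) *
            bin2_transform ((fps_X ^ n * fps_low n u - fps_high n u) \<odot>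
                            (fps_X ^ n * fps_low n v + fps_high n v))) $ j = 0"
proof -
  have "bin2_transform ((fps_X ^ n * fps_low n u - fps_high n u) \<odot>
          (fps_X ^ n * fps_low n v + fps_high n v)) $ i = 0" if "i \<le> j" for i
    using that assms
    by (auto intro!: sum.neutral
        simp: bin2_transform_def termwise_def fps_high_def fps_of_int_fps_def fps_X_power_mult_nth)
  then show ?thesis
    by (subst fps_mult_nth_cong [where h = 0]) auto
qed

lemma diamond_trunc_nth_eq_0:
  fixes u v :: "'a::comm_ring_1 fps"
  assumes "j < n"
  shows "diamond_trunc N n u v $ j = 0"
  using assms
proof (induction N n u v arbitrary: j rule: diamond_trunc.induct)
  case (1 N n u v)
  show ?case
  proof (cases "n = 0 \<or> n \<ge> N")
    case True
    then show ?thesis by (subst diamond_trunc.simps) simp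
  next
    case False
    have "((1 + fps_X ^ n) *
        diamond_trunc N (2 * n) (fps_X ^ n * fps_low n u - fps_high n u)
          (fps_X ^ n * fps_low n v + fps_high n v)) $ j = 0"
      by (subst fps_mult_nth_cong [where h = 0]) (use 1 False in auto)
    moreover have "diamond_trunc N (2 * n) u v $ j = 0"
      using 1 False by auto
    ultimately show ?thesis
      using False diamond_head_nth [OF \<open>j < n\<close>, of u v]
      by (subst diamond_trunc.simps) (simp del: One_nat_def)
  qed
qed

lemma diamond_trunc_nth_cong:
  fixes u v :: "'a::comm_ring_1 fps"
  assumes "j < N" "N \<le> N'"
  shows "diamond_trunc N' n u v $ j = diamond_trunc N n u v $ j"
  using assms
proof (induction N n u v arbitrary: j rule: diamond_trunc.induct)
  case (1 N n u v)
  consider "n = 0" | "n \<ge> N" | "n \<noteq> 0" "n < N" by linarith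
  then show ?case
  proof cases
    case 1
    then show ?thesis by (subst (1 2) diamond_trunc.simps) simp
  next
    case 2
    then have "diamond_trunc N n u v $ j = 0" "diamond_trunc N' n u v $ j = 0"
      using "1.prems" by (auto intro: diamond_trunc_nth_eq_0)
    then show ?thesis by simp
  next
    case 3
    have "((1 + fps_X ^ n) *
        diamond_trunc N' (2 * n) (fps_X ^ n * fps_low n u - fps_high n u)
          (fps_X ^ n * fps_low n v + fps_high n v)) $ j = ((1 + fps_X ^ n) *
        diamond_trunc N (2 * n) (fps_X ^ n * fps_low n u - fps_high n u)
          (fps_X ^ n * fps_low n v + fps_high n v)) $ j"
      by (rule fps_mult_nth_cong) (use 1 3 in auto)
    moreover have "diamond_trunc N' (2 * n) u v $ j = diamond_trunc N (2 * n) u v $ j"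
      using 1 3 by auto
    ultimately show ?thesis
      using 3 "1.prems" by (subst (1 2) diamond_trunc.simps) (simp del: One_nat_def)
  qed
qed

lemma diamond_trunc_tendsto:
  "(\<lambda>M. diamond_trunc (2 ^ M) n u v) \<longlonglongrightarrow> u \<diamondop>\<^bsub>n\<^esub> v"
proof -
  have "(\<lambda>M. diamond_trunc (2 ^ M) n u v) \<longlonglongrightarrow> Abs_fps (\<lambda>j. diamond_trunc (2 ^ j) n u v $ j)"
  proof (rule tendsto_fpsI)
    fix j
    show "\<forall>\<^sub>F M in sequentially. diamond_trunc (2 ^ M) n u v $ j =
            Abs_fps (\<lambda>j. diamond_trunc (2 ^ j) n u v $ j) $ j"
      using eventually_ge_at_top [of j]
    proof eventually_elim
      case (elim M)
      then have "diamond_trunc (2 ^ M) n u v $ j = diamond_trunc (2 ^ j) n u v $ j"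
        by (intro diamond_trunc_nth_cong) auto
      then show ?case by simp
    qed
  qed
  then show ?thesis
    unfolding diamond_def by (simp only: limI)
qed

lemma diamond_nth:
  assumes "j < 2 ^ M"
  shows "(u \<diamondop>\<^bsub>n\<^esub> v) $ j = diamond_trunc (2 ^ M) n u v $ j"
proof -
  have "\<forall>\<^sub>F M' in sequentially. diamond_trunc (2 ^ M') n u v $ j = (u \<diamondop>\<^bsub>n\<^esub> v) $ j"
    using diamond_trunc_tendsto [of n u v] unfolding tendsto_fps_iff by blast
  then have "\<forall>\<^sub>F M' in sequentially. (u \<diamondop>\<^bsub>n\<^esub> v) $ j = diamond_trunc (2 ^ M) n u v $ j"
    using eventually_ge_at_top [of M]
    by eventually_elim (metis assms diamond_trunc_nth_cong one_le_numeral power_increasing)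
  then show ?thesis by simp
qed

lemma diamond_rec:
  fixes u v :: "'a::comm_ring_1 fps"
  assumes "n > 0"
  shows "u \<diamondop>\<^bsub>n\<^esub> v =
      (1 + fps_X ^ n) *
        bin2_transform ((fps_X ^ n * fps_low n u - fps_high n u) \<odot>
                        (fps_X ^ n * fps_low n v + fps_high n v))
    + u \<diamondop>\<^bsub>2 * n\<^esub> v
    + (1 + fps_X ^ n) *
        ((fps_X ^ n * fps_low n u - fps_high n u) \<diamondop>\<^bsub>2 * n\<^esub>
         (fps_X ^ n * fps_low n v + fps_high n v))"
proof (rule fps_ext)
  fix j
  define M where "M = j + n"
  have "j + n < 2 ^ M"
    unfolding M_def by simp
  then have M: "n < 2 ^ M" "\<And>i. i \<le> j \<Longrightarrow> i < 2 ^ M"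
    by linarith+
  have "((1 + fps_X ^ n) *
      ((fps_X ^ n * fps_low n u - fps_high n u) \<diamondop>\<^bsub>2 * n\<^esub>
         (fps_X ^ n * fps_low n v + fps_high n v))) $ j = ((1 + fps_X ^ n) *
      diamond_trunc (2 ^ M) (2 * n) (fps_X ^ n * fps_low n u - fps_high n u)
        (fps_X ^ n * fps_low n v + fps_high n v)) $ j"
    by (rule fps_mult_nth_cong) (simp add: diamond_nth M)
  then show "(u \<diamondop>\<^bsub>n\<^esub> v) $ j =
    ((1 + fps_X ^ n) *
        bin2_transform ((fps_X ^ n * fps_low n u - fps_high n u) \<odot>
                        (fps_X ^ n * fps_low n v + fps_high n v))
    + u \<diamondop>\<^bsub>2 * n\<^esub> v
    + (1 + fps_X ^ n) *
        ((fps_X ^ n * fps_low n u - fps_high n u) \<diamondop>\<^bsub>2 * n\<^esub>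
         (fps_X ^ n * fps_low n v + fps_high n v))) $ j"
    using M(1) assms
    by (simp add: diamond_nth [OF M(2) [OF order_refl]] diamond_trunc.simps [of "2 ^ M" n u v]
        del: One_nat_def)
qed

end

theory Submission
  imports Defs
begin

text \<open>
  Write a power series as \<open>u(x) = u0(x^2) + x * u1(x^2)\<close>; passing to the sections \<open>u0\<close> and \<open>u1\<close>
  strips the lowest binary digit from every exponent. All ingredients of the theorem are governed
  by binary digits, so they are self-similar under this operation: Lucas' theorem modulo 2 and the
  Thue--Morse recursion describe the sections of both transforms, and the identity
  \<open>S_2n(x) = S_n(x^2)\<close> describes those of \<open>\<delta>_2n\<close>. As a consequence \<open>\<diamondop>_2n\<close> is, up to one transform step
  on the last digit, \<open>\<diamondop>_n\<close> acting on the sections (\<open>part_diamond\<close>).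

  Substitute \<open>u\<close> for the signed inverse transform of \<open>f\<close> and \<open>v\<close> for the inverse transform of \<open>g\<close>.
  The transforms being inverse to each other, the claim becomes \<open>F(u, v) = H(u, v)\<close>, where
  \<open>F\<close> (\<open>signed_product\<close>) is the product of the transforms of \<open>u\<close> with signs and of \<open>v\<close>, and \<open>H\<close>
  (\<open>diamond_product\<close>) is the right-hand side. For a single binary digit, the transforms of \<open>u\<close>
  with signs and of \<open>v\<close> are \<open>(1 + x) * u0 - x * u1\<close> and \<open>(1 + x) * v0 + x * v1\<close>, and
  \<open>((1 + x) * u0 - x * u1) * ((1 + x) * v0 + x * v1)
     = (1 + x) * u0 * v0 + x * u1 * v1 + x * (1 + x) * (u0 - u1) * (v0 + v1)\<close>.
  Accordingly, with all products on the right replaced by \<open>F\<close> of the sections, evaluated at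
  \<open>x^2\<close>, the same equation holds for \<open>F\<close>. The three summands are also exactly what the recursion for
  \<open>\<diamondop>_1\<close> produces, because the series \<open>x * u_low - u_high\<close> and \<open>x * v_low + v_high\<close> occurring there have
  even section 0 and odd sections \<open>u0 - u1\<close> and \<open>v0 + v1\<close>; thus \<open>H\<close> satisfies the equation too. A
  coefficient of index \<open>j > 0\<close> on the left involves on the right only coefficients of index at most
  \<open>j div 2\<close>, so the equation and the constant coefficient determine the solution.
\<close>

section \<open>Even and odd sections of a power series\<close>

definition even_part :: "'a::comm_ring_1 fps \<Rightarrow> 'a fps" where
  "even_part u = Abs_fps (\<lambda>j. u $ (2 * j))"

definition odd_part :: "'a::comm_ring_1 fps \<Rightarrow> 'a fps" where
  "odd_part u = Abs_fps (\<lambda>j. u $ (2 * j + 1))"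

lemma even_part_nth [simp]: "even_part u $ j = u $ (2 * j)"
  by (simp add: even_part_def)

lemma odd_part_nth [simp]: "odd_part u $ j = u $ (2 * j + 1)"
  by (simp add: odd_part_def)

lemma part_linear [simp]:
  "even_part 0 = 0" "odd_part 0 = 0"
  "even_part (u + v) = even_part u + even_part v" "odd_part (u + v) = odd_part u + odd_part v"
  "even_part (u - v) = even_part u - even_part v" "odd_part (u - v) = odd_part u - odd_part v"
  by (simp_all add: fps_eq_iff)

lemma part_one [simp]: "even_part 1 = 1" "odd_part 1 = 0"
  by (simp_all add: fps_eq_iff)

lemma part_X [simp]: "even_part fps_X = 0" "odd_part fps_X = 1"
  by (auto simp: fps_eq_iff fps_X_def)

lemma part_X_power [simp]:
  "even_part (fps_X ^ (2 * n)) = fps_X ^ n" "odd_part (fps_X ^ (2 * n)) = 0"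
  by (auto simp: fps_eq_iff fps_X_power_iff) presburger

lemma sum_upto_double:
  fixes h :: "nat \<Rightarrow> 'a::comm_monoid_add"
  shows "(\<Sum>i=0..2 * n. h i) = (\<Sum>i=0..n. h (2 * i)) + (\<Sum>i<n. h (2 * i + 1))"
    and "(\<Sum>i=0..2 * n + 1. h i) = (\<Sum>i=0..n. h (2 * i)) + (\<Sum>i=0..n. h (2 * i + 1))"
proof -
  show *: "(\<Sum>i=0..2 * n. h i) = (\<Sum>i=0..n. h (2 * i)) + (\<Sum>i<n. h (2 * i + 1))"
    by (induction n) (simp_all add: ac_simps)
  show "(\<Sum>i=0..2 * n + 1. h i) = (\<Sum>i=0..n. h (2 * i)) + (\<Sum>i=0..n. h (2 * i + 1))"
    using * by (simp add: ac_simps atLeast0AtMost flip: lessThan_Suc_atMost)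
qed

lemma even_part_mult:
  "even_part (u * v) = even_part u * even_part v + fps_X * (odd_part u * odd_part v)"
proof (rule fps_ext)
  fix j
  have "(\<Sum>i<j. u $ (2 * i + 1) * v $ (2 * j - (2 * i + 1))) =
      (fps_X * (odd_part u * odd_part v)) $ j"
  proof (cases j)
    case (Suc k)
    have "(\<Sum>i<Suc k. u $ (2 * i + 1) * v $ (2 * Suc k - (2 * i + 1))) =
        (\<Sum>i=0..k. u $ (2 * i + 1) * v $ (2 * (k - i) + 1))"
      by (intro sum.cong) (auto simp: atLeast0AtMost lessThan_Suc_atMost Suc_diff_le diff_mult_distrib2)
    then show ?thesis
      using Suc by (simp only: fps_X_mult_nth fps_mult_nth [of "odd_part u"] odd_part_nth) simp
  qed simp
  then show "even_part (u * v) $ j =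
      (even_part u * even_part v + fps_X * (odd_part u * odd_part v)) $ j"
    by (simp add: fps_mult_nth sum_upto_double diff_mult_distrib2)
qed

lemma odd_part_mult:
  "odd_part (u * v) = even_part u * odd_part v + odd_part u * even_part v"
proof (rule fps_ext)
  fix j
  have "(\<Sum>i=0..j. u $ (2 * i) * v $ (2 * j + 1 - 2 * i)) =
      (\<Sum>i=0..j. u $ (2 * i) * v $ (2 * (j - i) + 1))"
    by (intro sum.cong) (auto simp: Suc_diff_le diff_mult_distrib2)
  then show "odd_part (u * v) $ j = (even_part u * odd_part v + odd_part u * even_part v) $ j"
    unfolding odd_part_nth fps_mult_nth sum_upto_double
    by (simp add: fps_mult_nth diff_mult_distrib2)
qed

lemma part_termwise [simp]:
  "even_part (u \<odot> v) = even_part u \<odot> even_part v"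
  "odd_part (u \<odot> v) = odd_part u \<odot> odd_part v"
  by (simp_all add: fps_eq_iff termwise_def)

lemma part_fps_of_int_fps [simp]:
  "even_part (fps_of_int_fps u) = fps_of_int_fps (even_part u)"
  "odd_part (fps_of_int_fps u) = fps_of_int_fps (odd_part u)"
  by (simp_all add: fps_eq_iff fps_of_int_fps_def)

section \<open>Binary digits: binomial parities and Thue--Morse signs\<close>

lemma odd_binomial_Suc_Suc:
  "odd (Suc n choose Suc k) \<longleftrightarrow> odd (n choose k) \<noteq> odd (n choose Suc k)"
  by simp

lemma odd_binomial_odd_row:
  assumes "\<And>k. odd (2 * n choose 2 * k) = odd (n choose k)" "\<And>k. even (2 * n choose (2 * k + 1))"
  shows "odd ((2 * n + 1) choose 2 * k) = odd (n choose k)"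
    and "odd ((2 * n + 1) choose (2 * k + 1)) = odd (n choose k)"
proof -
  show "odd ((2 * n + 1) choose (2 * k + 1)) = odd (n choose k)"
    using odd_binomial_Suc_Suc [of "2 * n" "2 * k"] assms(1,2)[of k] by (simp del: binomial_Suc_Suc)
  show "odd ((2 * n + 1) choose 2 * k) = odd (n choose k)"
  proof (cases k)
    case (Suc m)
    then show ?thesis
      using odd_binomial_Suc_Suc [of "2 * n" "2 * m + 1"] assms(1)[of k] assms(2)[of m]
      by (simp del: binomial_Suc_Suc)
  qed simp
qed

text \<open>
  Lucas' theorem modulo 2 for the last binary digit. Entries \<open>2 * k\<close> and \<open>2 * k + 1\<close> of an odd
  row are congruent, so their sum, which is entry \<open>2 * k + 1\<close> of the next row, is even.
\<close>
lemma odd_binomial_even_row: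
  "odd (2 * n choose 2 * k) = odd (n choose k)" "even (2 * n choose (2 * k + 1))"
proof (induction n arbitrary: k)
  case 0
  { case 1 show ?case by (cases k) simp_all }
  { case 2 show ?case by simp }
next
  case (Suc n)
  note row = odd_binomial_odd_row [OF Suc.IH]
  { case 1
    show ?case
    proof (cases k)
      case (Suc m)
      then show ?thesis
        using odd_binomial_Suc_Suc [of "2 * n + 1" "2 * m + 1"] row(1) [of k] row(2) [of m]
          odd_binomial_Suc_Suc [of n m]
        by (simp del: binomial_Suc_Suc)
    qed simp }
  { case 2
    show ?case
      using odd_binomial_Suc_Suc [of "2 * n + 1" "2 * k"] row [of k]
      by (simp del: binomial_Suc_Suc) }
qed

lemma sierp_double:
  "sierp (2 * n) (2 * k) = sierp n k"
  "sierp (2 * n) (2 * k + 1) = 0"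
  "sierp (2 * n + 1) (2 * k) = sierp n k"
  "sierp (2 * n + 1) (2 * k + 1) = sierp n k"
  using odd_binomial_even_row [of n k] odd_binomial_odd_row [OF odd_binomial_even_row, of n k]
  unfolding sierp_def mod2_eq_if by simp_all

lemma sierp_eq_0: "n < k \<Longrightarrow> sierp n k = 0"
  by (simp add: sierp_def binomial_eq_0)

lemma thue_morse_double:
  "thue_morse (2 * j) = thue_morse j"
  "thue_morse (2 * j + 1) = - thue_morse j"
proof -
  have fin: "finite {i. bit j i}" for j :: nat
  proof (rule finite_subset)
    have "i < j" if "bit j i" for i
    proof (rule ccontr)
      assume "\<not> i < j"
      then have "j < 2 ^ i"
        using less_exp [of i] by linarith
      with that show False
        by (simp add: bit_iff_odd)
    qed
    then show "{i. bit j i} \<subseteq> {..<j}" by auto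
  qed simp
  have e: "{i. bit (2 * j) i} = Suc ` {i. bit j i}"
  proof (rule set_eqI)
    show "i \<in> {i. bit (2 * j) i} \<longleftrightarrow> i \<in> Suc ` {i. bit j i}" for i
      by (cases i) (auto simp: bit_Suc bit_0)
  qed
  have o: "{i. bit (2 * j + 1) i} = insert 0 (Suc ` {i. bit j i})"
  proof (rule set_eqI)
    show "i \<in> {i. bit (2 * j + 1) i} \<longleftrightarrow> i \<in> insert 0 (Suc ` {i. bit j i})" for i
      by (cases i) (auto simp: bit_Suc bit_0)
  qed
  show "thue_morse (2 * j) = thue_morse j"
    unfolding thue_morse_def e by (simp add: card_image)
  show "thue_morse (2 * j + 1) = - thue_morse j"
    unfolding thue_morse_def o using fin by (simp add: card_image)
qed

lemma thue_morse_0 [simp]: "thue_morse 0 = 1"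
proof -
  have empty: "{i. bit (0 :: nat) i} = {}" by simp
  show ?thesis unfolding thue_morse_def empty by simp
qed

section \<open>Sections of the transforms\<close>

lemma part_fps_signed [simp]:
  "even_part (fps_signed u) = fps_signed (even_part u)"
  "odd_part (fps_signed u) = - fps_signed (odd_part u)"
  unfolding fps_eq_iff fps_signed_def even_part_nth odd_part_nth fps_nth_Abs_fps fps_neg_nth
    thue_morse_double
  by simp_all

lemma fps_signed_signed [simp]: "fps_signed (fps_signed u) = u"
proof -
  have "thue_morse j * thue_morse j = 1" for j
    by (simp add: thue_morse_def flip: power_mult_distrib)
  then have "of_int (thue_morse j) * (of_int (thue_morse j) * u $ j) = u $ j" for j
    by (metis mult.assoc mult_1 of_int_1 of_int_mult)
  then show ?thesis
    by (simp add: fps_eq_iff fps_signed_def)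
qed

lemma bin2_transform_add: "bin2_transform (u + v) = bin2_transform u + bin2_transform v"
  by (simp add: fps_eq_iff bin2_transform_def algebra_simps sum.distrib)

lemma bin2_transform_diff: "bin2_transform (u - v) = bin2_transform u - bin2_transform v"
  by (metis add_diff_cancel bin2_transform_add diff_add_cancel)

lemma bin2_transform_0 [simp]: "bin2_transform 0 = 0"
  by (simp add: fps_eq_iff bin2_transform_def)

lemma part_bin2_transform [simp]:
  "even_part (bin2_transform u) = bin2_transform (even_part u)"
  "odd_part (bin2_transform u) = bin2_transform (even_part u) + bin2_transform (odd_part u)"
  unfolding fps_eq_iff bin2_transform_def even_part_nth odd_part_nth fps_nth_Abs_fps
    fps_add_nth sum_upto_double sierp_double
  by simp_all

lemma part_bin2_inverse_transform [simp]:
  "even_part (bin2_inverse_transform u) = bin2_inverse_transform (even_part u)"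
  "odd_part (bin2_inverse_transform u) =
    bin2_inverse_transform (odd_part u) - bin2_inverse_transform (even_part u)"
proof -
  have *: "thue_morse (2 * n - 2 * k) = thue_morse (n - k)"
    "thue_morse (2 * n + 1 - (2 * k + 1)) = thue_morse (n - k)" for n k
    using thue_morse_double(1) [of "n - k"] by (simp_all add: diff_mult_distrib2)
  have **: "thue_morse (2 * n + 1 - 2 * k) = - thue_morse (n - k)" if "k \<le> n" for n k
  proof -
    have "2 * n + 1 - 2 * k = 2 * (n - k) + 1" using that by simp
    then show ?thesis using thue_morse_double(2) by simp
  qed
  show "even_part (bin2_inverse_transform u) = bin2_inverse_transform (even_part u)"
    unfolding fps_eq_iff bin2_inverse_transform_def even_part_nth odd_part_nth fps_nth_Abs_fps
      sum_upto_double sierp_double * by simp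
  show "odd_part (bin2_inverse_transform u) =
    bin2_inverse_transform (odd_part u) - bin2_inverse_transform (even_part u)"
    unfolding fps_eq_iff bin2_inverse_transform_def even_part_nth odd_part_nth fps_nth_Abs_fps
      fps_sub_nth sum_upto_double sierp_double *
    by (simp add: ** [simplified] sum_negf)
qed

text \<open>
  Coefficients \<open>2 * k\<close> and \<open>2 * k + 1\<close> of a series are coefficients \<open>k\<close> of its sections, hence reduce
  to smaller indices unless \<open>2 * k = k\<close>. The induction hypothesis covers all \<open>i \<le> k\<close> because a
  factor \<open>x\<close> in an equation between sections turns \<open>k\<close> into \<open>k - 1\<close>.
\<close>
lemma even_odd_induct:
  fixes P :: "nat \<Rightarrow> bool"
  assumes "P 0" "\<And>k. 0 < k \<Longrightarrow> (\<And>i. i \<le> k \<Longrightarrow> P i) \<Longrightarrow> P (2 * k)"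
    "\<And>k. (\<And>i. i \<le> k \<Longrightarrow> P i) \<Longrightarrow> P (2 * k + 1)"
  shows "P j"
proof (induction j rule: less_induct)
  case (less j)
  consider "j = 0" | k where "j = 2 * k" "k > 0" | k where "j = 2 * k + 1"
    by (metis oddE evenE mult_0_right neq0_conv)
  then show ?case
    by cases (use assms less in auto)
qed

text \<open>
  On the last digit the transform is \<open>(a, b) \<mapsto> (a, a + b)\<close> and the inverse transform is
  \<open>(a, b) \<mapsto> (a, b - a)\<close>; the remaining digits are dealt with by induction.
\<close>
lemma bin2_transform_inverse_transform: "bin2_transform (bin2_inverse_transform u) = u"
proof (rule fps_ext)
  fix j
  show "bin2_transform (bin2_inverse_transform u) $ j = u $ j"
  proof (induction j arbitrary: u rule: even_odd_induct)
    case 1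
    show ?case
      by (simp add: bin2_transform_def bin2_inverse_transform_def sierp_def)
  next
    case (2 k)
    then show ?case
      using even_part_nth [of "bin2_transform (bin2_inverse_transform u)" k] by simp
  next
    case (3 k)
    then show ?case
      using odd_part_nth [of "bin2_transform (bin2_inverse_transform u)" k]
      by (simp add: bin2_transform_diff)
  qed
qed

section \<open>Sections of the diamond operators\<close>

lemma part_sierp_poly:
  "even_part (fps_of_poly (sierp_poly (2 * n))) = fps_of_poly (sierp_poly n)"
  "odd_part (fps_of_poly (sierp_poly (2 * n))) = 0"
proof -
  have c: "coeff (sierp_poly m) j = int (sierp m j)" for m j
    by (simp add: sierp_poly_def coeff_sum sierp_eq_0)
  show "even_part (fps_of_poly (sierp_poly (2 * n))) = fps_of_poly (sierp_poly n)"
    "odd_part (fps_of_poly (sierp_poly (2 * n))) = 0"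
    using sierp_double [of n] by (simp_all add: fps_eq_iff c)
qed

lemma sierp_delta_unique:
  assumes "((1 - fps_X) * fps_of_poly (sierp_poly k)) * d = 1"
  shows "d = sierp_delta k"
proof -
  have "d = ((1 - fps_X) * fps_of_poly (sierp_poly k) * sierp_delta k) * d"
    by (simp only: sierp_delta_inverse mult_1)
  also have "\<dots> = ((1 - fps_X) * fps_of_poly (sierp_poly k) * d) * sierp_delta k"
    by (simp only: ac_simps)
  finally show ?thesis
    by (simp only: assms mult_1)
qed

text \<open>
  Since \<open>S_2n(x) = S_n(x^2)\<close>, the series \<open>(1 + x) * \<delta>_n(x^2)\<close> is inverse to \<open>(1 - x) * S_2n(x)\<close>.
\<close>
lemma part_sierp_delta [simp]:
  "even_part (sierp_delta (2 * n)) = sierp_delta n"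
  "odd_part (sierp_delta (2 * n)) = sierp_delta n"
proof -
  let ?S = "fps_of_poly (sierp_poly n)" and ?d = "sierp_delta (2 * n)"
  have "even_part (((1 - fps_X) * fps_of_poly (sierp_poly (2 * n))) * ?d) = 1"
    "odd_part (((1 - fps_X) * fps_of_poly (sierp_poly (2 * n))) * ?d) = 0"
    by (simp_all only: sierp_delta_inverse part_one)
  then have e: "?S * even_part ?d - fps_X * (?S * odd_part ?d) = 1"
    and o: "?S * odd_part ?d = ?S * even_part ?d"
    by (simp_all add: even_part_mult odd_part_mult part_sierp_poly)
  show "even_part ?d = sierp_delta n"
    by (rule sierp_delta_unique) (use e [unfolded o] in \<open>simp add: left_diff_distrib mult.assoc\<close>)
  show "odd_part ?d = sierp_delta n"
    by (rule sierp_delta_unique)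
      (use e [folded o] in \<open>simp add: left_diff_distrib mult.assoc\<close>)
qed

text \<open>
  Here \<open>\<delta>_1 = 1 / ((1 - x) * (1 + x)) = 1 / (1 - x^2)\<close>, so that low and high parts for \<open>n = 1\<close> select the
  even and the odd exponents.
\<close>
lemma part_sierp_delta_1 [simp]:
  "even_part (sierp_delta 1) = Abs_fps (\<lambda>_. 1)"
  "odd_part (sierp_delta 1) = 0"
proof -
  have S: "fps_of_poly (sierp_poly 1) = 1 + fps_X"
    by (simp add: sierp_poly_def sierp_def fps_of_poly_add fps_of_poly_monom)
  let ?g = "Abs_fps (\<lambda>_. 1) :: int fps"
  have g: "(1 - fps_X) * ?g = 1"
    by (auto simp: fps_eq_iff algebra_simps)
  have cancel: "a = ?g * ((1 - fps_X) * a)" for a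
    using g by (simp add: mult.commute [of ?g] flip: mult.assoc)
  have d: "even_part ((1 - fps_X) * (1 + fps_X) * sierp_delta 1) = 1"
    "odd_part ((1 - fps_X) * (1 + fps_X) * sierp_delta 1) = 0"
    by (simp_all only: sierp_delta_inverse part_one flip: S)
  have d: "(1 - fps_X) * even_part (sierp_delta 1) = 1" "(1 - fps_X) * odd_part (sierp_delta 1) = 0"
    using d by (simp_all add: even_part_mult odd_part_mult del: One_nat_def)
  show "even_part (sierp_delta 1) = ?g" "odd_part (sierp_delta 1) = 0"
    using cancel [of "even_part (sierp_delta 1)"] cancel [of "odd_part (sierp_delta 1)"]
    unfolding d by simp_all
qed

lemma part_fps_low_high_double [simp]:
  "even_part (fps_low (2 * n) u) = fps_low n (even_part u)"
  "odd_part (fps_low (2 * n) u) = fps_low n (odd_part u)"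
  "even_part (fps_high (2 * n) u) = fps_high n (even_part u)"
  "odd_part (fps_high (2 * n) u) = fps_high n (odd_part u)"
  unfolding fps_low_def fps_high_def part_termwise part_fps_of_int_fps even_part_mult odd_part_mult
    part_sierp_delta part_X_power by simp_all

lemma part_fps_low_high_1 [simp]:
  fixes u :: "'a::comm_ring_1 fps"
  shows "even_part (fps_low 1 u) = even_part u" "odd_part (fps_low 1 u) = 0"
    "even_part (fps_high 1 u) = 0" "odd_part (fps_high 1 u) = odd_part u"
proof -
  have "even_part (fps_X ^ 1 * sierp_delta 1) = 0"
    "odd_part (fps_X ^ 1 * sierp_delta 1) = Abs_fps (\<lambda>_. 1)"
    unfolding power_one_right even_part_mult odd_part_mult part_sierp_delta_1 part_X by simp_all
  moreover have "w \<odot> fps_of_int_fps (Abs_fps (\<lambda>_. 1)) = w" "w \<odot> fps_of_int_fps 0 = 0" for w :: "'a fps"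
    by (simp_all add: fps_eq_iff termwise_def fps_of_int_fps_def)
  ultimately show "even_part (fps_low 1 u) = even_part u" "odd_part (fps_low 1 u) = 0"
    "even_part (fps_high 1 u) = 0" "odd_part (fps_high 1 u) = odd_part u"
    unfolding fps_low_def fps_high_def part_termwise part_fps_of_int_fps part_sierp_delta_1
    by (simp_all only:)
qed

text \<open>
  Every operation in the recursion for \<open>2 * n\<close> acts on the sections as its counterpart for \<open>n\<close> does,
  except for the outer transform, which adds the even section to the odd one. The cutoff must be
  doubled as well, so that both recursions have the same depth.
\<close>
lemma part_diamond_trunc:
  fixes u v :: "'a::comm_ring_1 fps"
  shows "even_part (diamond_trunc (2 * N) (2 * n) u v) =
      diamond_trunc N n (even_part u) (even_part v)" (is "?E N n u v")
    and "odd_part (diamond_trunc (2 * N) (2 * n) u v) =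
      diamond_trunc N n (even_part u) (even_part v) + diamond_trunc N n (odd_part u) (odd_part v)"
      (is "?O N n u v")
proof -
  have "?E N n u v \<and> ?O N n u v"
  proof (induction "N - n" arbitrary: n u v rule: less_induct)
    case less
    show ?case
    proof (cases "n = 0 \<or> n \<ge> N")
      case True
      then show ?thesis
        by (subst (1 2 3 4 5) diamond_trunc.simps) simp
    next
      case False
      then have IH: "?E N (2 * n) u v" "?O N (2 * n) u v" for u v
        using less [of "2 * n"] by auto
      show ?thesis
        unfolding diamond_trunc.simps [of "2 * N" "2 * n"] diamond_trunc.simps [of N n]
        using False IH by (simp add: even_part_mult odd_part_mult) (simp add: algebra_simps)
    qed
  qed
  then show "?E N n u v" "?O N n u v" by auto
qed

lemma part_diamond [simp]:
  fixes u v :: "'a::comm_ring_1 fps"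
  shows "even_part (u \<diamondop>\<^bsub>2 * n\<^esub> v) = even_part u \<diamondop>\<^bsub>n\<^esub> even_part v"
    and "odd_part (u \<diamondop>\<^bsub>2 * n\<^esub> v) =
      (even_part u \<diamondop>\<^bsub>n\<^esub> even_part v) + (odd_part u \<diamondop>\<^bsub>n\<^esub> odd_part v)"
proof -
  have j: "2 * j < 2 ^ Suc j" "2 * j + 1 < 2 ^ Suc j" "j < 2 ^ j" for j :: nat
    using Suc_leI [OF less_exp [of j]] by auto
  show "even_part (u \<diamondop>\<^bsub>2 * n\<^esub> v) = even_part u \<diamondop>\<^bsub>n\<^esub> even_part v"
  proof (rule fps_ext)
    fix j
    show "even_part (u \<diamondop>\<^bsub>2 * n\<^esub> v) $ j = (even_part u \<diamondop>\<^bsub>n\<^esub> even_part v) $ j"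
      unfolding even_part_nth diamond_nth [OF j(1) [of j]] diamond_nth [OF j(3) [of j]]
      using part_diamond_trunc(1) [of "2 ^ j" n u v]
      by (simp add: fps_eq_iff)
  qed
  show "odd_part (u \<diamondop>\<^bsub>2 * n\<^esub> v) =
      (even_part u \<diamondop>\<^bsub>n\<^esub> even_part v) + (odd_part u \<diamondop>\<^bsub>n\<^esub> odd_part v)"
  proof (rule fps_ext)
    fix j
    show "odd_part (u \<diamondop>\<^bsub>2 * n\<^esub> v) $ j =
        ((even_part u \<diamondop>\<^bsub>n\<^esub> even_part v) + (odd_part u \<diamondop>\<^bsub>n\<^esub> odd_part v)) $ j"
      unfolding odd_part_nth diamond_nth [OF j(2) [of j]] diamond_nth [OF j(3) [of j]] fps_add_nth
      using part_diamond_trunc(2) [of "2 ^ j" n u v]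
      by (simp add: fps_eq_iff)
  qed
qed

lemma diamond_trunc_0_0 [simp]: "diamond_trunc N n 0 0 = 0"
proof (induction "N - n" arbitrary: n rule: less_induct)
  case less
  have "fps_low n (0 :: 'a fps) = 0" "fps_high n (0 :: 'a fps) = 0" "(0 :: 'a fps) \<odot> 0 = 0"
    by (simp_all add: fps_low_def fps_high_def termwise_def fps_eq_iff)
  then show ?case
    using less [of "2 * n"] by (subst diamond_trunc.simps) auto
qed

lemma diamond_0_0 [simp]: "0 \<diamondop>\<^bsub>n\<^esub> 0 = 0"
  by (simp add: diamond_def)

section \<open>The common functional equation\<close>

definition diamond_product :: "'a::comm_ring_1 fps \<Rightarrow> 'a fps \<Rightarrow> 'a fps" where
  "diamond_product u v = bin2_transform (u \<odot> v) + u \<diamondop>\<^bsub>1\<^esub> v"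

text \<open>
  One unfolding of the recursion at \<open>n = 1\<close> turns everything into \<open>\<diamondop>_2\<close>, which is \<open>\<diamondop>_1\<close> on sections.
  The two series combined in the new term are supported on odd exponents.
\<close>
lemma part_diamond_product:
  fixes u v :: "'a::comm_ring_1 fps"
  defines "u0 \<equiv> even_part u" and "u1 \<equiv> odd_part u" and "v0 \<equiv> even_part v" and "v1 \<equiv> odd_part v"
  shows "even_part (diamond_product u v) =
      diamond_product u0 v0 + fps_X * diamond_product (u0 - u1) (v0 + v1)"
    and "odd_part (diamond_product u v) =
      diamond_product u0 v0 + diamond_product u1 v1 + diamond_product (u0 - u1) (v0 + v1)"
proof -
  define U where "U = fps_X ^ 1 * fps_low 1 u - fps_high 1 u"
  define V where "V = fps_X ^ 1 * fps_low 1 v + fps_high 1 v"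
  have U: "even_part U = 0" "odd_part U = u0 - u1" "even_part V = 0" "odd_part V = v0 + v1"
    by (simp_all add: U_def V_def even_part_mult odd_part_mult u0_def u1_def v0_def v1_def
        del: One_nat_def)
  have z: "(0 :: 'a fps) \<odot> 0 = 0"
    by (simp add: termwise_def fps_eq_iff)
  define K where "K = bin2_transform (U \<odot> V) + U \<diamondop>\<^bsub>2 * 1\<^esub> V"
  have K: "even_part K = 0" "odd_part K = diamond_product (u0 - u1) (v0 + v1)"
    unfolding K_def part_linear part_bin2_transform part_termwise part_diamond U
    by (simp_all add: z diamond_product_def)
  have D: "diamond_product u v = bin2_transform (u \<odot> v) + u \<diamondop>\<^bsub>2 * 1\<^esub> v + (1 + fps_X) * K"
    unfolding diamond_product_def K_def U_def V_def diamond_rec [OF zero_less_one, of u v]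
    by (simp add: algebra_simps)
  show "even_part (diamond_product u v) =
      diamond_product u0 v0 + fps_X * diamond_product (u0 - u1) (v0 + v1)"
    unfolding D part_linear part_bin2_transform part_termwise part_diamond even_part_mult K
    by (simp add: diamond_product_def u0_def v0_def)
  show "odd_part (diamond_product u v) =
      diamond_product u0 v0 + diamond_product u1 v1 + diamond_product (u0 - u1) (v0 + v1)"
    unfolding D part_linear part_bin2_transform part_termwise part_diamond odd_part_mult K
    by (simp add: diamond_product_def u0_def v0_def u1_def v1_def)
qed

definition signed_product :: "'a::comm_ring_1 fps \<Rightarrow> 'a fps \<Rightarrow> 'a fps" where
  "signed_product u v = bin2_transform (fps_signed u) * bin2_transform v"

text \<open>
  This is the one-digit product identity: the sections of the first factor are \<open>a0\<close> and \<open>a0 - a1\<close>,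
  those of the second \<open>b0\<close> and \<open>b0 + b1\<close>, where the \<open>a\<close> and \<open>b\<close> are the transforms of the sections of \<open>u\<close>
  (with signs) and \<open>v\<close>.
\<close>
lemma part_signed_product:
  fixes u v :: "'a::comm_ring_1 fps"
  defines "u0 \<equiv> even_part u" and "u1 \<equiv> odd_part u" and "v0 \<equiv> even_part v" and "v1 \<equiv> odd_part v"
  shows "even_part (signed_product u v) =
      signed_product u0 v0 + fps_X * signed_product (u0 - u1) (v0 + v1)"
    and "odd_part (signed_product u v) =
      signed_product u0 v0 + signed_product u1 v1 + signed_product (u0 - u1) (v0 + v1)"
proof -
  have [simp]: "fps_signed (u0 - u1) = fps_signed u0 - fps_signed u1"
    by (simp add: fps_signed_def fps_eq_iff algebra_simps)
  have [simp]: "bin2_transform (- w) = - bin2_transform w" for w :: "'a fps"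
    using bin2_transform_diff [of 0 w] by simp
  show "even_part (signed_product u v) =
      signed_product u0 v0 + fps_X * signed_product (u0 - u1) (v0 + v1)"
    "odd_part (signed_product u v) =
      signed_product u0 v0 + signed_product u1 v1 + signed_product (u0 - u1) (v0 + v1)"
    by (simp_all add: signed_product_def even_part_mult odd_part_mult bin2_transform_diff
        bin2_transform_add algebra_simps flip: u0_def u1_def v0_def v1_def)
qed

lemma signed_product_eq_diamond_product: "signed_product u v = diamond_product u v"
proof (rule fps_ext)
  fix j
  show "signed_product u v $ j = diamond_product u v $ j"
  proof (induction j arbitrary: u v rule: even_odd_induct)
    case 1
    have "(u \<diamondop>\<^bsub>1\<^esub> v) $ 0 = 0"
      by (simp add: diamond_nth [of 0 0] diamond_trunc_nth_eq_0 del: One_nat_def)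
    then show ?case
      by (simp add: signed_product_def diamond_product_def bin2_transform_def fps_signed_def
          termwise_def sierp_def)
  next
    case (2 k)
    have "even_part (signed_product u v) $ k = even_part (diamond_product u v) $ k"
      unfolding part_signed_product part_diamond_product using 2 by (simp add: fps_X_mult_nth)
    then show ?case by simp
  next
    case (3 k)
    have "odd_part (signed_product u v) $ k = odd_part (diamond_product u v) $ k"
      unfolding part_signed_product part_diamond_product using 3 by simp
    then show ?case by simp
  qed
qed

theorem mainTheorem4:
  fixes f g :: "'a::comm_ring_1 fps"
  shows "f * g =
      bin2_transform (fps_signed (bin2_inverse_transform f) \<odot> bin2_inverse_transform g)
    + fps_signed (bin2_inverse_transform f) \<diamondop>\<^bsub>1\<^esub> bin2_inverse_transform g"
proof -
  have "f * g = signed_product (fps_signed (bin2_inverse_transform f)) (bin2_inverse_transform g)"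
    by (simp add: signed_product_def bin2_transform_inverse_transform)
  then show ?thesis
    by (simp only: signed_product_eq_diamond_product diamond_product_def)
qed

end
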